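(* For every positive integer $k$, $$\left(\frac{5^{k}-3}{2}\right)^5 - \left(\frac{5^{k}-1}{2}\right)^{5} - \left(\frac{5^{k}+1}{2}\right)^5 + \left(\frac{5^{k}+3}{2}\right)^5 = 5^{k+2}+5^{3k+1}.$$
   Context: The identity is an equality of rational numbers. *)

theory Defs
  imports Complex_Main
begin

end

theory Submission
  imports Defs
begin

text \<open>The identity has nothing to do with powers of 5 beyond their multiplicativity: it is
  the polynomial identity below at \<open>x = 5 ^ k\<close>.  Expanding \<open>((x + a) / 2) ^ 5 + ((x - a) / 2) ^ 5\<close>
  leaves only the terms even in \<open>a\<close>, that is, \<open>(x ^ 5 + 10 * a\<^sup>2 * x ^ 3 + 5 * a ^ 4 * x) / 16\<close>.
  Subtracting the case \<open>a = 1\<close> from the case \<open>a = 3\<close> cancels \<open>x ^ 5\<close>, and the coefficients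
  \<open>10 * (9 - 1) / 16 = 5\<close> and \<open>5 * (81 - 1) / 16 = 25\<close> of the remaining terms are powers of 5.\<close>

lemma four_fifth_powers_identity:
  fixes x :: "'a :: field_char_0"
  shows "((x - 3) / 2) ^ 5 - ((x - 1) / 2) ^ 5 - ((x + 1) / 2) ^ 5 + ((x + 3) / 2) ^ 5
         = 25 * x + 5 * x ^ 3"
  by (simp add: field_simps eval_nat_numeral)

theorem theorem1p1:
  fixes k :: nat
  assumes "k > 0"
  shows "(((5::rat) ^ k - 3) / 2) ^ 5 - ((5 ^ k - 1) / 2) ^ 5
           - ((5 ^ k + 1) / 2) ^ 5 + ((5 ^ k + 3) / 2) ^ 5
         = 5 ^ (k + 2) + 5 ^ (3 * k + 1)"
  unfolding four_fifth_powers_identity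
  by (simp add: power_add power_mult power_mult_distrib mult.commute[of 3 k])

end
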